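(* Let $f,g$ be smooth vector fields on $\mathbb{R}^n$ and assume that the system $\dot x=f(x)+u\,g(x)$ is super-linearized as $\dot z=A_\ell z+B_\ell u+D_\ell$ with observables $p:\mathbb{R}^n\to\mathbb{R}^m$. Let $$A_\ell=\begin{bmatrix} A & G \\ H & M \end{bmatrix},\quad B_\ell=\begin{bmatrix} B \\ C \end{bmatrix},\quad D_\ell=\begin{bmatrix} D \\ E \end{bmatrix}$$ be block partitions with $A\in\mathbb{R}^{n\times n}$, $G\in\mathbb{R}^{n\times m}$, $H\in\mathbb{R}^{m\times n}$, $M\in\mathbb{R}^{m\times m}$, $B,D\in\mathbb{R}^n$, $C,E\in\mathbb{R}^m$. Then the system $\dot x=f(x)+u\,g(x)$ is of the form $$\dot x=Ax+Gp(x)+Bu+D,$$ i.e. $f(x)+u\,g(x)=Ax+Gp(x)+Bu+D$ for all $x\in\mathbb{R}^n$ and all $u\in\mathbb{R}$.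
   Context: $(f,g)$ denotes the control system $\dot x=f(x)+u\,g(x)$, $x\in\mathbb{R}^n$, with scalar control $u$; $e^{t(f+ug)}x_0$ denotes its solution at time $t$ with initial state $x_0$ and control $u(t)$. Similarly, for $A_\ell\in\mathbb{R}^{(n+m)\times(n+m)}$ and $B_\ell,D_\ell\in\mathbb{R}^{n+m}$, $e^{t(A_\ell z+B_\ell u+D_\ell)}z_0$ denotes the solution at time $t$ of the affine control system $\dot z=A_\ell z+B_\ell u+D_\ell$ with $z(0)=z_0$. $\Pi:\mathbb{R}^{n+m}\to\mathbb{R}^n$ is the projection onto the first $n$ coordinates. Super-linearization: $(f,g)$ is super-linearized to $(A_\ell,B_\ell,D_\ell)$ with observables $p$, where $m\ge 0$ and $p:\mathbb{R}^n\to\mathbb{R}^m$ is a smooth map, if for all $x_0\in\mathbb{R}^n$ and every control $u(t)$, $$\Pi\left(e^{t(A_\ell z+B_\ell u+D_\ell)}z_0\right)=e^{t(f+ug)}x_0,\qquad z_0=(x_0,p(x_0)),$$ as long as the solutions exist. *)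

theory Defs
  imports "HOL-Analysis.Analysis"
begin

(* The recursion stays at the type of f by differentiating in a fixed but
   arbitrary direction v. *)
primrec times_continuously_differentiable ::
  "nat \<Rightarrow> ('a::euclidean_space \<Rightarrow> 'b::euclidean_space) \<Rightarrow> bool" where
  "times_continuously_differentiable 0 f \<longleftrightarrow> continuous_on UNIV f"
| "times_continuously_differentiable (Suc k) f \<longleftrightarrow>
     (\<forall>x. f differentiable (at x)) \<and>
     (\<forall>v. times_continuously_differentiable k (\<lambda>x. frechet_derivative f (at x) v))"

definition smooth :: "('a::euclidean_space \<Rightarrow> 'b::euclidean_space) \<Rightarrow> bool" where
  "smooth f \<longleftrightarrow> (\<forall>k. times_continuously_differentiable k f)"

definition block_vec :: "real ^ 'n \<Rightarrow> real ^ 'm \<Rightarrow> real ^ ('n::finite + 'm::finite)" where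
  "block_vec x y = (\<chi> i. case i of Inl a \<Rightarrow> x $ a | Inr b \<Rightarrow> y $ b)"

definition block_mat ::
  "real ^ 'n ^ 'n \<Rightarrow> real ^ 'm ^ 'n \<Rightarrow> real ^ 'n ^ 'm \<Rightarrow> real ^ 'm ^ 'm
     \<Rightarrow> real ^ ('n::finite + 'm::finite) ^ ('n::finite + 'm::finite)" where
  "block_mat A G H M =
     (\<chi> i. case i of Inl a \<Rightarrow> block_vec (A $ a) (G $ a) | Inr b \<Rightarrow> block_vec (H $ b) (M $ b))"

definition proj_first :: "real ^ ('n::finite + 'm::finite) \<Rightarrow> real ^ 'n" where
  "proj_first z = (\<chi> i. z $ Inl i)"

(* Controls: on every compact interval, continuous up to finitely many jumps. *)
definition piecewise_continuous :: "(real \<Rightarrow> real) \<Rightarrow> bool" where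
  "piecewise_continuous u \<longleftrightarrow>
     (\<forall>a b. \<exists>S. finite S \<and> continuous_on ({a..b} - S) u \<and>
        (\<forall>s\<in>S. (\<exists>l. (u \<longlongrightarrow> l) (at_left s)) \<and> (\<exists>r. (u \<longlongrightarrow> r) (at_right s))))"

(* x' = F t x, x 0 = x0 on {0..T}, in integral form since the control, and hence x',
   may jump.  The initial condition is the case t = 0. *)
definition solution_on ::
  "(real \<Rightarrow> 'a \<Rightarrow> 'a) \<Rightarrow> real \<Rightarrow> 'a \<Rightarrow> (real \<Rightarrow> 'a::euclidean_space) \<Rightarrow> bool" where
  "solution_on F T x0 x \<longleftrightarrow>
     continuous_on {0..T} x \<and>
     (\<forall>t\<in>{0..T}. ((\<lambda>s. F s (x s)) has_integral (x t - x0)) {0..t})"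

(* Solutions are unique (f and g being smooth), so quantifying over all solutions x and z
   is the same as speaking of the solution; "as long as the solutions exist" is the
   quantification over the common existence interval {0..T}. *)
definition lifts_to_affine ::
  "(real ^ 'n \<Rightarrow> real ^ 'n) \<Rightarrow> (real ^ 'n \<Rightarrow> real ^ 'n) \<Rightarrow>
   real ^ 'k ^ 'k \<Rightarrow> real ^ 'k \<Rightarrow> real ^ 'k \<Rightarrow>
   (real ^ 'n \<Rightarrow> real ^ 'k) \<Rightarrow> (real ^ 'k \<Rightarrow> real ^ 'n) \<Rightarrow> bool" where
  "lifts_to_affine f g Al Bl Dl lift proj \<longleftrightarrow>
     (\<forall>x0 u T x z.
        piecewise_continuous u \<and>
        solution_on (\<lambda>t x. f x + u t *\<^sub>R g x) T x0 x \<and>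
        solution_on (\<lambda>t z. Al *v z + u t *\<^sub>R Bl + Dl) T (lift x0) z
        \<longrightarrow> (\<forall>t\<in>{0..T}. proj (z t) = x t))"

definition super_linearized ::
  "(real ^ 'n \<Rightarrow> real ^ 'n) \<Rightarrow> (real ^ 'n \<Rightarrow> real ^ 'n) \<Rightarrow>
   real ^ ('n::finite + 'm::finite) ^ ('n::finite + 'm::finite) \<Rightarrow> real ^ ('n::finite + 'm::finite) \<Rightarrow> real ^ ('n::finite + 'm::finite) \<Rightarrow>
   (real ^ 'n \<Rightarrow> real ^ 'm) \<Rightarrow> bool" where
  "super_linearized f g Al Bl Dl p \<longleftrightarrow>
     smooth p \<and> lifts_to_affine f g Al Bl Dl (\<lambda>x. block_vec x (p x)) proj_first"

(* The case of no observables, m = 0: it is not an instance of the above because an index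
   type 'm cannot be empty.  Here z0 = x0 and the projection is the identity. *)
definition super_linearized_no_observables ::
  "(real ^ 'n \<Rightarrow> real ^ 'n) \<Rightarrow> (real ^ 'n \<Rightarrow> real ^ 'n) \<Rightarrow>
   real ^ 'n ^ 'n \<Rightarrow> real ^ 'n \<Rightarrow> real ^ 'n \<Rightarrow> bool" where
  "super_linearized_no_observables f g Al Bl Dl \<longleftrightarrow>
     lifts_to_affine f g Al Bl Dl (\<lambda>x. x) (\<lambda>z. z)"

end

theory Submission
  imports Defs
begin

text \<open>
  The idea is to compare the two trajectories at time zero.  Freeze the control at a constant
  value \<open>u\<close> and start at \<open>x0\<close>.  The nonlinear trajectory leaves \<open>x0\<close> with velocity
  \<open>f x0 + u *\<^sub>R g x0\<close>, and the projected affine trajectory leaves it with the first block of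
  \<open>A\<^sub>\<ell> z0 + u B\<^sub>\<ell> + D\<^sub>\<ell>\<close>, where \<open>z0 = (x0, p x0)\<close>.  As the two curves coincide,
  the velocities are equal, and the first block is \<open>A x0 + G p(x0) + u B + D\<close>.

  The hypothesis speaks only about solutions that exist, so the argument would be vacuous
  without some solution on an interval of positive length.  Most of the work is therefore
  the local existence theorem of Picard and Lindelof for autonomous systems
  (\<open>local_solution_exists\<close>).  It needs a Lipschitz bound near \<open>x0\<close>, which smoothness of \<open>f\<close>
  and \<open>g\<close> provides (\<open>smooth_lipschitz_on_cball\<close>).  The comparison of velocities is carried out once, for an
  arbitrary lift and an arbitrary bounded linear projection (\<open>lifts_to_affine_vector_field\<close>), so
  that it covers the system with observables and the one without.
\<close>

section \<open>Local existence of solutions\<close>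

text \<open>
  Directional derivatives of a smooth map are continuous, hence bounded on the ball; finitely
  many of them, those along a basis, bound the operator norm of the derivative, and the mean
  value inequality applies because the ball is convex.
\<close>

lemma smooth_lipschitz_on_cball:
  fixes f :: "'a::euclidean_space \<Rightarrow> 'b::euclidean_space"
  assumes "smooth f"
  obtains L where "L-lipschitz_on (cball a r) f"
proof -
  let ?D = "\<lambda>x. frechet_derivative f (at x)"
  have C1: "times_continuously_differentiable (Suc 0) f"
    using assms unfolding smooth_def by blast
  then have diff: "f differentiable (at x)" and cont: "continuous_on UNIV (\<lambda>x. ?D x v)" for x v
    by simp_all
  have deriv: "(f has_derivative ?D x) (at x)" for x
    using diff frechet_derivative_works by blast
  have "\<exists>K. \<forall>x\<in>cball a r. norm (?D x b) \<le> K" for b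
  proof -
    have "compact ((\<lambda>x. ?D x b) ` cball a r)"
      by (intro compact_continuous_image continuous_on_subset[OF cont]) auto
    then show ?thesis
      by (auto dest!: compact_imp_bounded simp: bounded_iff)
  qed
  then obtain K where K: "\<And>b x. x \<in> cball a r \<Longrightarrow> norm (?D x b) \<le> K b"
    by metis
  define L where "L = max 0 (\<Sum>b\<in>Basis. K b)"
  have "onorm (?D x) \<le> L" if x: "x \<in> cball a r" for x
  proof (rule onorm_bound)
    show "0 \<le> L" by (simp add: L_def)
    fix v
    have lin: "linear (?D x)"
      using deriv has_derivative_linear by blast
    have "?D x v = ?D x (\<Sum>b\<in>Basis. (v \<bullet> b) *\<^sub>R b)"
      by (simp add: euclidean_representation)
    also have "\<dots> = (\<Sum>b\<in>Basis. (v \<bullet> b) *\<^sub>R ?D x b)"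
      using lin by (simp add: linear_sum linear_scale)
    finally have "norm (?D x v) \<le> (\<Sum>b\<in>Basis. norm ((v \<bullet> b) *\<^sub>R ?D x b))"
      by (metis norm_sum)
    also have "\<dots> \<le> (\<Sum>b\<in>Basis. norm v * K b)"
      by (auto intro!: sum_mono mult_mono simp: Basis_le_norm K[OF x])
    also have "\<dots> = (\<Sum>b\<in>Basis. K b) * norm v"
      by (simp add: sum_distrib_left mult.commute)
    also have "\<dots> \<le> L * norm v"
      by (intro mult_right_mono) (auto simp: L_def)
    finally show "norm (?D x v) \<le> L * norm v" .
  qed
  then have "norm (f x - f y) \<le> L * norm (x - y)" if "x \<in> cball a r" "y \<in> cball a r" for x y
    using that deriv differentiable_bound[OF convex_cball, of a r f ?D L x y]
    by (meson has_derivative_at_withinI)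
  then have "L-lipschitz_on (cball a r) f"
    by (intro lipschitz_onI) (auto simp: dist_norm L_def)
  then show ?thesis ..
qed

text \<open>
  On curves that stay in the unit ball around \<open>x0\<close>, the Picard operator
  \<open>\<phi> \<mapsto> (t \<mapsto> x0 + \<integral>\<^sub>0\<^sup>t F \<circ> \<phi>)\<close> is a contraction for a short time \<open>T\<close>, and its fixed point
  is a solution.  The curves are defined on the whole line, since bounded continuous functions on
  a type form a complete space; the operator clamps time to \<open>{0..T}\<close> so that its values are
  again bounded.
\<close>

lemma local_solution_exists:
  fixes F :: "'a::euclidean_space \<Rightarrow> 'a"
  assumes cont: "continuous_on UNIV F" and lip: "L-lipschitz_on (cball x0 1) F"
  obtains T x where "0 < T" "solution_on (\<lambda>_. F) T x0 x"
proof -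
  have "compact (F ` cball x0 1)"
    by (intro compact_continuous_image continuous_on_subset[OF cont]) auto
  then obtain K where K: "0 < K" "\<And>y. y \<in> cball x0 1 \<Longrightarrow> norm (F y) \<le> K"
    by (auto dest!: compact_imp_bounded simp: bounded_pos)
  have L0: "0 \<le> L"
    using lip lipschitz_on_nonneg by blast
  \<comment> \<open>\<open>K * T \<le> 1\<close> keeps the curves in the ball, \<open>L * T \<le> 1/2\<close> makes the operator contract.\<close>
  define T where "T = min (1 / K) (1 / (2 * (L + 1)))"
  have T0: "0 < T"
    using K L0 by (simp add: T_def)
  have KT: "K * T \<le> 1"
  proof -
    have "K * T \<le> K * (1 / K)"
      using K by (intro mult_left_mono) (auto simp: T_def)
    then show ?thesis using K by simp
  qed
  have LT: "L * T \<le> 1/2"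
  proof -
    have "L * T \<le> (L + 1) * (1 / (2 * (L + 1)))"
      using L0 T0 by (intro mult_mono) (auto simp: T_def)
    also have "\<dots> = 1/2"
      using L0 by (simp add: field_simps)
    finally show ?thesis .
  qed
  define S :: "(real \<Rightarrow>\<^sub>C 'a) set" where "S = PiC UNIV (\<lambda>_. cball x0 1)"
  have S_iff: "\<phi> \<in> S \<longleftrightarrow> (\<forall>t. apply_bcontfun \<phi> t \<in> cball x0 1)" for \<phi>
    by (auto simp: S_def mem_PiC_iff)
  have F\<phi>: "continuous_on A (\<lambda>s. F (apply_bcontfun \<phi> s))" for A and \<phi> :: "real \<Rightarrow>\<^sub>C 'a"
    by (rule continuous_on_compose2[OF cont]) auto
  have "\<exists>\<psi> :: real \<Rightarrow>\<^sub>C 'a. \<forall>t. \<psi> t = x0 + integral {0..clamp 0 T t} (\<lambda>s. F (\<phi> s))"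
    for \<phi> :: "real \<Rightarrow>\<^sub>C 'a"
  proof -
    have "continuous_on (cbox 0 T) (\<lambda>t. x0 + integral {0..t} (\<lambda>s. F (\<phi> s)))"
      unfolding interval_cbox[symmetric]
      by (intro continuous_intros indefinite_integral_continuous_1 integrable_continuous_real F\<phi>)
    then show ?thesis
      by (rule continuous_on_cbox_bcontfunE) blast
  qed
  then obtain P :: "(real \<Rightarrow>\<^sub>C 'a) \<Rightarrow> (real \<Rightarrow>\<^sub>C 'a)"
    where P: "\<And>\<phi> t. P \<phi> t = x0 + integral {0..clamp 0 T t} (\<lambda>s. F (\<phi> s))"
    by metis
  have clampT: "0 \<le> clamp 0 T t" "clamp 0 T t \<le> T" for t :: real
    using clamp_in_interval[of 0 T t] T0 by auto
  have "\<exists>!\<phi>. \<phi> \<in> S \<and> P \<phi> = \<phi>"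
  proof (rule Banach_fix)
    show "complete S"
      by (simp add: S_def closed_PiC complete_eq_closed)
    have "const_bcontfun x0 \<in> S"
      by (simp add: S_iff const_bcontfun.rep_eq)
    then show "S \<noteq> {}" by blast
    show "0 \<le> (1/2::real)" "(1/2::real) < 1" by simp_all
    show "P ` S \<subseteq> S"
    proof
      fix \<psi> assume "\<psi> \<in> P ` S"
      then obtain \<phi> where \<phi>: "\<phi> \<in> S" "\<psi> = P \<phi>" by blast
      have "norm (integral {0..clamp 0 T t} (\<lambda>s. F (\<phi> s))) \<le> K * (clamp 0 T t - 0)" for t
        using \<phi> K by (intro integral_bound clampT F\<phi>) (auto simp: S_iff)
      also have "K * (clamp 0 T t - 0) \<le> K * T" for t
        using K clampT[of t] by (intro mult_left_mono) auto
      finally show "\<psi> \<in> S"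
        using KT by (auto simp: S_iff \<phi> P dist_norm intro: order_trans)
    qed
    show "dist (P \<phi>) (P \<psi>) \<le> 1/2 * dist \<phi> \<psi>" if "\<phi> \<in> S" "\<psi> \<in> S" for \<phi> \<psi>
    proof (rule dist_bound)
      fix t
      have "dist (P \<phi> t) (P \<psi> t)
          = norm (integral {0..clamp 0 T t} (\<lambda>s. F (\<phi> s) - F (\<psi> s)))"
        by (simp add: P dist_norm integral_diff integrable_continuous_real F\<phi>)
      also have "\<dots> \<le> L * dist \<phi> \<psi> * (clamp 0 T t - 0)"
      proof (intro integral_bound clampT continuous_intros F\<phi>)
        fix s
        have "norm (F (\<phi> s) - F (\<psi> s)) \<le> L * dist (\<phi> s) (\<psi> s)"
          using lipschitz_onD[OF lip] that by (simp add: S_iff dist_norm)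
        also have "\<dots> \<le> L * dist \<phi> \<psi>"
          by (intro mult_left_mono dist_bounded L0)
        finally show "norm (F (\<phi> s) - F (\<psi> s)) \<le> L * dist \<phi> \<psi>" .
      qed
      also have "\<dots> \<le> L * dist \<phi> \<psi> * T"
        using clampT[of t] L0 by (intro mult_left_mono) auto
      also have "\<dots> = (L * T) * dist \<phi> \<psi>" by simp
      also have "\<dots> \<le> 1/2 * dist \<phi> \<psi>"
        by (intro mult_right_mono LT) auto
      finally show "dist (P \<phi> t) (P \<psi> t) \<le> 1/2 * dist \<phi> \<psi>" .
    qed
  qed
  then obtain \<phi> where \<phi>: "P \<phi> = \<phi>" by blast
  have "\<phi> t = x0 + integral {0..t} (\<lambda>s. F (\<phi> s))" if "t \<in> {0..T}" for t
    using P[of \<phi> t] that by (simp add: \<phi>)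
  then have "((\<lambda>s. F (\<phi> s)) has_integral (\<phi> t - x0)) {0..t}" if "t \<in> {0..T}" for t
    using that integrable_integral[OF integrable_continuous_real[OF F\<phi>]] by fastforce
  then have "solution_on (\<lambda>_. F) T x0 \<phi>"
    by (simp add: solution_on_def)
  with T0 show ?thesis ..
qed

lemma solution_on_mono:
  assumes "solution_on F T x0 x" and "T' \<le> T"
  shows "solution_on F T' x0 x"
  using assms unfolding solution_on_def by (auto intro: continuous_on_subset)

section \<open>Comparison of initial velocities\<close>

lemma solution_initial_value:
  assumes sol: "solution_on F T x0 x" and "0 \<le> T"
  shows "x 0 = x0"
proof -
  have "\<forall>t\<in>{0..T}. ((\<lambda>s. F s (x s)) has_integral (x t - x0)) {0..t}"
    using sol by (simp add: solution_on_def)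
  moreover have "0 \<in> {0..T}"
    using \<open>0 \<le> T\<close> by simp
  ultimately have "((\<lambda>s. F s (x s)) has_integral (x 0 - x0)) {0..0}"
    by (rule bspec)
  from integral_unique[OF this] show ?thesis
    by simp
qed

text \<open>
  Solutions are given in integral form only, but the integrand of an autonomous continuous
  system is continuous, so the fundamental theorem of calculus applies up to the endpoint \<open>0\<close>.
\<close>

lemma solution_initial_velocity:
  assumes sol: "solution_on (\<lambda>_. F) T x0 x" and cont: "continuous_on UNIV F" and "0 \<le> T"
  shows "(x has_vector_derivative F x0) (at 0 within {0..T})"
proof (rule has_vector_derivative_transform)
  have "continuous_on {0..T} (\<lambda>s. F (x s))"
    using sol by (intro continuous_on_compose2[OF cont]) (auto simp: solution_on_def)
  then have "((\<lambda>t. integral {0..t} (\<lambda>s. F (x s))) has_vector_derivative F (x 0)) (at 0 within {0..T})"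
    using \<open>0 \<le> T\<close> by (intro integral_has_vector_derivative) auto
  then show "((\<lambda>t. x0 + integral {0..t} (\<lambda>s. F (x s))) has_vector_derivative F x0) (at 0 within {0..T})"
    using solution_initial_value[OF sol \<open>0 \<le> T\<close>] has_vector_derivative_add[OF has_vector_derivative_const]
    by fastforce
  show "x t = x0 + integral {0..t} (\<lambda>s. F (x s))" if "t \<in> {0..T}" for t
    using sol that by (auto simp: solution_on_def dest!: bspec integral_unique)
qed (use \<open>0 \<le> T\<close> in auto)

lemma piecewise_continuous_const: "piecewise_continuous (\<lambda>_. c)"
  unfolding piecewise_continuous_def by (intro allI exI[of _ "{}"]) auto

text \<open>
  The curves \<open>x\<close> and \<open>proj \<circ> z\<close> agree on an interval of positive length, so their one-sided
  derivatives at time zero agree.  Constant controls suffice, because they already take every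
  value \<open>u\<close> at time zero, and they make both systems autonomous.
\<close>

lemma lifts_to_affine_vector_field:
  fixes f g :: "real ^ 'n \<Rightarrow> real ^ 'n" and Al :: "real ^ 'k ^ 'k"
  assumes "smooth f" and "smooth g"
    and lifts: "lifts_to_affine f g Al Bl Dl lift proj" and proj: "bounded_linear proj"
  shows "f x0 + u *\<^sub>R g x0 = proj (Al *v lift x0 + u *\<^sub>R Bl + Dl)"
proof -
  let ?F = "\<lambda>x. f x + u *\<^sub>R g x" and ?Fl = "\<lambda>z. Al *v z + u *\<^sub>R Bl + Dl"
  obtain Lf where Lf: "Lf-lipschitz_on (cball x0 1) f"
    using assms(1) by (rule smooth_lipschitz_on_cball)
  obtain Lg where Lg: "Lg-lipschitz_on (cball x0 1) g"
    using assms(2) by (rule smooth_lipschitz_on_cball)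
  have lip: "(Lf + \<bar>u\<bar> * Lg)-lipschitz_on (cball x0 1) ?F"
    by (rule lipschitz_on_add[OF Lf lipschitz_on_cmult[OF Lg]])
  have "continuous_on UNIV f" "continuous_on UNIV g"
    using assms(1,2) by (auto simp: smooth_def dest: spec[of _ 0])
  then have cont: "continuous_on UNIV ?F"
    by (intro continuous_intros)
  have bl: "bounded_linear ((*v) Al)"
    by (rule matrix_vector_mul_bounded_linear)
  then obtain Ll where "Ll-lipschitz_on (cball (lift x0) 1) ((*v) Al)"
    by (rule bounded_linear.lipschitz_boundE)
  then have lipl: "(Ll + 0 + 0)-lipschitz_on (cball (lift x0) 1) ?Fl"
    by (intro lipschitz_on_add lipschitz_on_constant)
  have contl: "continuous_on UNIV ?Fl"
    by (intro continuous_intros bounded_linear.continuous_on[OF bl])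
  obtain Tz z where z: "0 < Tz" "solution_on (\<lambda>_. ?Fl) Tz (lift x0) z"
    by (rule local_solution_exists[OF contl lipl])
  obtain Tx x where x: "0 < Tx" "solution_on (\<lambda>_. ?F) Tx x0 x"
    by (rule local_solution_exists[OF cont lip])
  define T where "T = min Tx Tz"
  have T: "0 < T" using x z by (simp add: T_def)
  have solx: "solution_on (\<lambda>_. ?F) T x0 x" and solz: "solution_on (\<lambda>_. ?Fl) T (lift x0) z"
    using x z by (auto simp: T_def intro: solution_on_mono)
  have "\<forall>t\<in>{0..T}. proj (z t) = x t"
    using lifts solx solz piecewise_continuous_const[of u]
    unfolding lifts_to_affine_def by blast
  moreover have "((\<lambda>t. proj (z t)) has_vector_derivative proj (?Fl (lift x0))) (at 0 within {0..T})"
    using T by (intro bounded_linear.has_vector_derivative[OF proj]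
        solution_initial_velocity[OF solz contl]) auto
  ultimately have "(x has_vector_derivative proj (?Fl (lift x0))) (at 0 within {0..T})"
    using T by (auto intro: has_vector_derivative_transform[rotated 2])
  moreover have "(x has_vector_derivative ?F x0) (at 0 within {0..T})"
    using T by (intro solution_initial_velocity[OF solx cont]) auto
  moreover have "at 0 within {0..T} \<noteq> bot"
    using T by (simp add: trivial_limit_within)
  ultimately show ?thesis
    by (metis vector_derivative_unique_within)
qed

section \<open>The first block of the lifted system\<close>

lemma bounded_linear_proj_first: "bounded_linear proj_first"
  unfolding linear_conv_bounded_linear[symmetric]
  by (rule linearI) (simp_all add: proj_first_def vec_eq_iff)

lemma proj_first_block_vec: "proj_first (block_vec x y) = x"
  by (simp add: proj_first_def block_vec_def vec_eq_iff)

lemma proj_first_block_mat: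
  "proj_first (block_mat A G H M *v block_vec x y) = A *v x + G *v y"
  by (simp add: proj_first_def block_mat_def block_vec_def matrix_vector_mult_def vec_eq_iff
      UNIV_Plus_UNIV[symmetric] sum.Plus del: UNIV_Plus_UNIV)

theorem theorem1:
  fixes f g :: "real ^ 'n \<Rightarrow> real ^ 'n"
    and p :: "real ^ 'n \<Rightarrow> real ^ 'm"
    and A :: "real ^ 'n ^ 'n" and G :: "real ^ 'm ^ 'n"
    and H :: "real ^ 'n ^ 'm" and M :: "real ^ 'm ^ 'm"
    and B D :: "real ^ 'n" and C E :: "real ^ 'm"
  assumes "smooth f" and "smooth g"
  shows "(super_linearized f g (block_mat A G H M) (block_vec B C) (block_vec D E) p \<longrightarrow>
            (\<forall>x u. f x + u *\<^sub>R g x = A *v x + G *v p x + u *\<^sub>R B + D)) \<and>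
         (super_linearized_no_observables f g A B D \<longrightarrow>
            (\<forall>x u. f x + u *\<^sub>R g x = A *v x + u *\<^sub>R B + D))"
proof (intro conjI impI allI)
  fix x u
  assume "super_linearized f g (block_mat A G H M) (block_vec B C) (block_vec D E) p"
  then have "lifts_to_affine f g (block_mat A G H M) (block_vec B C) (block_vec D E)
      (\<lambda>x. block_vec x (p x)) proj_first"
    by (simp add: super_linearized_def)
  from lifts_to_affine_vector_field[OF assms this bounded_linear_proj_first]
  show "f x + u *\<^sub>R g x = A *v x + G *v p x + u *\<^sub>R B + D"
    by (simp add: linear_add linear_scale bounded_linear.linear[OF bounded_linear_proj_first]
        proj_first_block_vec proj_first_block_mat)
next
  fix x u
  assume "super_linearized_no_observables f g A B D"
  then have "lifts_to_affine f g A B D (\<lambda>x. x) (\<lambda>z. z)"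
    by (simp add: super_linearized_no_observables_def)
  from lifts_to_affine_vector_field[OF assms this bounded_linear_ident]
  show "f x + u *\<^sub>R g x = A *v x + u *\<^sub>R B + D" .
qed

end
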